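(* For each positive integer $n$, there exists a matrix $M\in\mathbb{R}_+^{2^n\times 2^n}$ with $\operatorname{rank}_+(M)=2^{\Omega(n)}$ and $\operatorname{rank}_{\mathrm{PSD}}(M)=O(n)$. (The constants in $\Omega(n)$ and $O(n)$ are independent of $n$.)
   Context: The nonnegative rank $\operatorname{rank}_+(M)$ of a nonnegative matrix $M$ is the smallest $r$ such that $M=TU$ with $T$ and $U$ entrywise nonnegative real matrices, $T$ having $r$ columns and $U$ having $r$ rows. The PSD rank $\operatorname{rank}_{\mathrm{PSD}}(M)$ of an $m\times n'$ matrix $M$ is the smallest $r$ such that there exist $r\times r$ real symmetric positive semidefinite matrices $T_1,\ldots,T_m$ and $U^1,\ldots,U^{n'}$ with $\operatorname{Tr}[T_iU^j]=M_{ij}$ for all $i,j$. "$=2^{\Omega(n)}$" means at least $2^{cn}$ for some constant $c>0$ and all sufficiently large $n$. *)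

theory Defs
  imports Complex_Main "Jordan_Normal_Form.Matrix"
begin

definition nonneg_mat :: "real mat \<Rightarrow> bool" where
  "nonneg_mat A \<longleftrightarrow> (\<forall>i < dim_row A. \<forall>j < dim_col A. 0 \<le> A $$ (i, j))"

definition nonneg_factorization :: "real mat \<Rightarrow> nat \<Rightarrow> bool" where
  "nonneg_factorization A r \<longleftrightarrow>
    (\<exists>T \<in> carrier_mat (dim_row A) r. \<exists>U \<in> carrier_mat r (dim_col A).
      nonneg_mat T \<and> nonneg_mat U \<and> A = T * U)"

text \<open>
  Only meaningful for entrywise nonnegative matrices; for those the least
  element exists, see \<open>nonneg_factorization_exists\<close> below.
\<close>
definition nonneg_rank :: "real mat \<Rightarrow> nat" where
  "nonneg_rank A = (LEAST r. nonneg_factorization A r)"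

definition psd_mat :: "nat \<Rightarrow> real mat \<Rightarrow> bool" where
  "psd_mat r A \<longleftrightarrow> A \<in> carrier_mat r r \<and> transpose_mat A = A \<and>
    (\<forall>v \<in> carrier_vec r. 0 \<le> v \<bullet> (A *\<^sub>v v))"

definition mat_trace :: "real mat \<Rightarrow> real" where
  "mat_trace A = (\<Sum>i < dim_row A. A $$ (i, i))"

definition psd_factorization :: "real mat \<Rightarrow> nat \<Rightarrow> bool" where
  "psd_factorization A r \<longleftrightarrow>
    (\<exists>T U :: nat \<Rightarrow> real mat.
      (\<forall>i < dim_row A. psd_mat r (T i)) \<and>
      (\<forall>j < dim_col A. psd_mat r (U j)) \<and>
      (\<forall>i < dim_row A. \<forall>j < dim_col A. mat_trace (T i * U j) = A $$ (i, j)))"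

text \<open>
  Again only meaningful for entrywise nonnegative matrices, where the least
  element exists by \<open>psd_factorization_exists\<close> below.
\<close>
definition psd_rank :: "real mat \<Rightarrow> nat" where
  "psd_rank A = (LEAST r. psd_factorization A r)"

lemma nonneg_factorization_exists:
  assumes "nonneg_mat A"
  shows "nonneg_factorization A (dim_col A)"
  unfolding nonneg_factorization_def
proof (intro bexI conjI)
  show "A = A * 1\<^sub>m (dim_col A)" by auto
qed (use assms in \<open>auto simp: nonneg_mat_def\<close>)

lemma psd_mat_diag:
  assumes "\<And>k. k < r \<Longrightarrow> 0 \<le> d k"
  shows "psd_mat r (mat r r (\<lambda>(k, l). if k = l then d k else 0))" (is "psd_mat r ?D")
proof -
  have "0 \<le> v \<bullet> (?D *\<^sub>v v)" if v: "v \<in> carrier_vec r" for v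
  proof -
    have "(?D *\<^sub>v v) $ k = d k * v $ k" if "k < r" for k
      using that v by (simp add: scalar_prod_def if_distrib[of "\<lambda>x. x * _"] cong: if_cong)
    hence "v \<bullet> (?D *\<^sub>v v) = (\<Sum>k = 0..<r. v $ k * (d k * v $ k))"
      using v by (simp add: scalar_prod_def)
    also have "\<dots> = (\<Sum>k = 0..<r. d k * (v $ k)\<^sup>2)"
      by (simp add: power2_eq_square mult_ac)
    also have "\<dots> \<ge> 0" using assms by (intro sum_nonneg) auto
    finally show ?thesis .
  qed
  moreover have "transpose_mat ?D = ?D" by (intro eq_matI) auto
  ultimately show ?thesis by (simp add: psd_mat_def)
qed

lemma psd_factorization_exists:
  assumes "nonneg_mat A"
  shows "psd_factorization A (dim_col A)"
proof -
  define r where "r = dim_col A"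
  define D where "D = (\<lambda>d :: nat \<Rightarrow> real. mat r r (\<lambda>(k, l). if k = l then d k else 0))"
  have tr: "mat_trace (D d * D e) = (\<Sum>k < r. d k * e k)" for d e
    by (simp add: mat_trace_def D_def scalar_prod_def if_distrib[of "\<lambda>x. x * _"] cong: if_cong)
  have "psd_mat r (D (\<lambda>k. A $$ (i, k)))" if "i < dim_row A" for i
    unfolding D_def using assms that by (intro psd_mat_diag) (auto simp: nonneg_mat_def r_def)
  moreover have "psd_mat r (D (\<lambda>k. if k = j then 1 else 0))" for j
    unfolding D_def by (intro psd_mat_diag) auto
  moreover have "mat_trace (D (\<lambda>k. A $$ (i, k)) * D (\<lambda>k. if k = j then 1 else 0)) = A $$ (i, j)"
    if "j < dim_col A" for i j
    unfolding tr using that by (simp add: r_def if_distrib[of "\<lambda>x. _ * x"] cong: if_cong)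
  ultimately show ?thesis
    unfolding psd_factorization_def r_def[symmetric]
    by (intro exI[of _ "\<lambda>i. D (\<lambda>k. A $$ (i, k))"] exI[of _ "\<lambda>j. D (\<lambda>k. if k = j then 1 else 0)"])
       (auto simp: r_def)
qed

end

theory Submission
  imports Defs
begin

text \<open>
  Index rows and columns by the subsets of \<open>{..<n}\<close> and take \<open>M(a,b) = (1 - |a \<inter> b|)\<^sup>2\<close>.
  This is the entrywise square of a matrix of rank at most \<open>n + 1\<close>, so rank-one PSD factors
  \<open>u\<^sub>a u\<^sub>a\<^sup>T\<close>, \<open>v\<^sub>b v\<^sub>b\<^sup>T\<close> of size \<open>n + 1\<close> suffice. For the nonnegative rank, each of the \<open>r\<close>
  summands of a factorization \<open>M = TU\<close> is supported on a rectangle avoiding the zeros of \<open>M\<close>, that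
  is, the pairs with \<open>|a \<inter> b| = 1\<close>. By the argument of Kaibel and Weltge, such a rectangle contains
  at most \<open>2\<^sup>n\<close> of the \<open>3\<^sup>n\<close> disjoint pairs, and \<open>M = 1\<close> on all of those; hence \<open>r \<ge> (3/2)\<^sup>n\<close>.
\<close>

definition disjoint_pairs :: "'a set set \<Rightarrow> 'a set set \<Rightarrow> ('a set \<times> 'a set) set" where
  "disjoint_pairs A B = {(a, b). a \<in> A \<and> b \<in> B \<and> a \<inter> b = {}}"

lemma finite_disjoint_pairs: "finite A \<Longrightarrow> finite B \<Longrightarrow> finite (disjoint_pairs A B)"
  by (rule finite_subset[of _ "A \<times> B"]) (auto simp: disjoint_pairs_def)

text \<open>Each point of \<open>X\<close> lies in neither set, only in the first or only in the
  second; \<open>h\<close> decodes these choices, written 0, 1, 2, into a disjoint pair.\<close>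

lemma card_disjoint_pairs_Pow_ge:
  assumes "finite X"
  shows "3 ^ card X \<le> card (disjoint_pairs (Pow X) (Pow X))"
proof -
  define F where "F = X \<rightarrow>\<^sub>E {0, 1, 2 :: nat}"
  define h where "h = (\<lambda>f :: 'a \<Rightarrow> nat. ({x \<in> X. f x = 1}, {x \<in> X. f x = 2}))"
  have "inj_on h F"
  proof (rule inj_onI)
    fix f g assume f: "f \<in> F" and g: "g \<in> F" and eq: "h f = h g"
    show "f = g"
    proof (rule PiE_ext[OF f[unfolded F_def] g[unfolded F_def]])
      fix x assume x: "x \<in> X"
      have "f x \<in> {0, 1, 2}" "g x \<in> {0, 1, 2}" using f g x unfolding F_def by blast+
      moreover have "f x = 1 \<longleftrightarrow> g x = 1" "f x = 2 \<longleftrightarrow> g x = 2"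
        using eq x unfolding h_def by blast+
      ultimately show "f x = g x" by auto
    qed
  qed
  moreover have "h ` F \<subseteq> disjoint_pairs (Pow X) (Pow X)"
    by (auto simp: h_def disjoint_pairs_def)
  ultimately have "card F \<le> card (disjoint_pairs (Pow X) (Pow X))"
    using assms by (intro card_inj_on_le finite_disjoint_pairs) auto
  thus ?thesis by (simp add: F_def card_PiE assms eval_nat_numeral)
qed

text \<open>Induction on the ground set: the disjoint pairs split into two classes, and deleting
  \<open>x\<close> embeds each class into the disjoint pairs of a rectangle over the smaller set to
  which the induction hypothesis applies. Each new point thus at most doubles the bound.\<close>

lemma card_disjoint_pairs_rectangle_le:
  assumes "finite X" "A \<subseteq> Pow X" "B \<subseteq> Pow X"
    and "\<And>a b. a \<in> A \<Longrightarrow> b \<in> B \<Longrightarrow> card (a \<inter> b) \<noteq> 1"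
  shows "card (disjoint_pairs A B) \<le> 2 ^ card X"
  using assms
proof (induction X arbitrary: A B rule: finite_induct)
  case empty
  have "disjoint_pairs A B \<subseteq> {({}, {})}" using empty by (auto simp: disjoint_pairs_def)
  hence "card (disjoint_pairs A B) \<le> card {({} :: 'a set, {} :: 'a set)}"
    by (intro card_mono) auto
  thus ?case by simp
next
  case (insert x X)
  define A0 where "A0 = {a \<in> A. x \<notin> a}"
  define A1 where "A1 = {a - {x} | a. a \<in> A}"
  define B0 where "B0 = {b \<in> B. x \<notin> b}"
  define B1 where "B1 = {b - {x} | b. b \<in> B}"
  define strip where "strip = (\<lambda>(a, b). (a - {x}, b - {x}))"
  define Z where "Z = disjoint_pairs A B"
  \<comment> \<open>A pair avoiding \<open>x\<close> goes to whichever half keeps \<open>strip\<close> injective; this is possible because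
    \<open>insert x a \<in> A\<close> and \<open>insert x b \<in> B\<close> cannot both hold for disjoint \<open>a\<close>, \<open>b\<close>.\<close>
  define Za where "Za = {(a, b) \<in> Z. x \<in> a \<or> x \<notin> b \<and> insert x a \<notin> A}"
  define Zb where "Zb = {(a, b) \<in> Z. x \<notin> a \<and> (x \<in> b \<or> insert x a \<in> A)}"
  have sub: "A0 \<subseteq> Pow X" "A1 \<subseteq> Pow X" "B0 \<subseteq> Pow X" "B1 \<subseteq> Pow X"
    using insert.prems by (auto simp: A0_def A1_def B0_def B1_def)
  have fin: "finite A0" "finite A1" "finite B0" "finite B1"
    using sub insert.hyps finite_subset[OF _ finite_Pow_iff[THEN iffD2]] by metis+
  \<comment> \<open>Deleting \<open>x\<close> from one set leaves the intersection unchanged when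
    the other set avoids \<open>x\<close>; hence \<open>A1\<close> is paired with \<open>B0\<close>,
    and \<open>A0\<close> with \<open>B1\<close>.\<close>
  have valid: "card (a \<inter> b) \<noteq> 1" if "a \<in> A1 \<and> b \<in> B0 \<or> a \<in> A0 \<and> b \<in> B1" for a b
  proof -
    from that obtain a' b' where "a' \<in> A" "b' \<in> B" "a \<inter> b = a' \<inter> b'"
      unfolding A0_def A1_def B0_def B1_def by blast
    thus ?thesis using insert.prems(3) by metis
  qed
  \<comment> \<open>No second component in \<open>Za\<close> contains \<open>x\<close>, so distinct
    pairs with equal image would differ exactly by \<open>x\<close> in the first one; the smaller
    first set then violates \<open>insert x a \<notin> A\<close>.\<close>
  have inja: "inj_on strip Za"
  proof (rule inj_onI, clarify)
    fix a b a' b' assume p: "(a, b) \<in> Za" "(a', b') \<in> Za" "strip (a, b) = strip (a', b')"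
    hence "x \<notin> b" "x \<notin> b'" "b - {x} = b' - {x}" "a - {x} = a' - {x}"
      by (auto simp: Za_def Z_def disjoint_pairs_def strip_def)
    moreover have "a \<in> A" "a' \<in> A" "x \<in> a \<or> insert x a \<notin> A" "x \<in> a' \<or> insert x a' \<notin> A"
      using p by (auto simp: Za_def Z_def disjoint_pairs_def)
    ultimately show "a = a' \<and> b = b'"
      by (metis Diff_insert_absorb insert_Diff insert_Diff_single insert_absorb)
  qed
  have injb: "inj_on strip Zb"
  proof -
    \<comment> \<open>Two such pairs would put \<open>insert x a\<close> in \<open>A\<close> and
      \<open>b\<close> in \<open>B\<close> with intersection exactly \<open>{x}\<close>, a forbidden
      size.\<close>
    have False if "(a, b) \<in> Zb" "(a, b') \<in> Zb" "x \<in> b" "x \<notin> b'" "b - {x} = b'" for a b b'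
    proof -
      have "insert x a \<in> A" "b \<in> B" "a \<inter> b = {}" using that
        by (auto simp: Zb_def Z_def disjoint_pairs_def)
      moreover from this have "insert x a \<inter> b = {x}" using that(3) by auto
      ultimately show False using insert.prems(3)[of "insert x a" b] by simp
    qed
    moreover have "x \<notin> a" if "(a, b) \<in> Zb" for a b using that by (auto simp: Zb_def)
    ultimately show ?thesis
      unfolding inj_on_def strip_def
      by clarsimp (metis Diff_empty Diff_insert0 insert_Diff)
  qed
  have "strip ` Za \<subseteq> disjoint_pairs A1 B0"
  proof (rule image_subsetI, clarify)
    fix a b assume "(a, b) \<in> Za"
    hence "a \<in> A" "b \<in> B" "a \<inter> b = {}" "x \<notin> b"
      by (auto simp: Za_def Z_def disjoint_pairs_def)
    thus "strip (a, b) \<in> disjoint_pairs A1 B0"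
      by (auto simp: disjoint_pairs_def strip_def A1_def B0_def)
  qed
  hence "card Za \<le> card (disjoint_pairs A1 B0)"
    using inja fin by (intro card_inj_on_le[of strip] finite_disjoint_pairs)
  also have "\<dots> \<le> 2 ^ card X" using valid sub by (intro insert.IH) auto
  finally have a: "card Za \<le> 2 ^ card X" .
  have "strip ` Zb \<subseteq> disjoint_pairs A0 B1"
    by (auto simp: Zb_def Z_def disjoint_pairs_def strip_def A0_def B1_def)
  hence "card Zb \<le> card (disjoint_pairs A0 B1)"
    using injb fin by (intro card_inj_on_le[of strip] finite_disjoint_pairs)
  also have "\<dots> \<le> 2 ^ card X" using valid sub by (intro insert.IH) auto
  finally have b: "card Zb \<le> 2 ^ card X" .
  have "Z = Za \<union> Zb" by (auto simp: Za_def Zb_def Z_def disjoint_pairs_def)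
  hence "card Z \<le> card Za + card Zb" by (simp add: card_Un_le)
  thus ?case using a b insert.hyps by (simp add: Z_def)
qed

text \<open>A covering count: the supports of column \<open>k\<close> of \<open>T\<close> and row
  \<open>k\<close> of \<open>U\<close> give the rectangle with sides \<open>A k\<close> and
  \<open>B k\<close>, and these \<open>r\<close> rectangles must cover all disjoint pairs.\<close>

lemma nonneg_factorization_disjointness_ge:
  fixes s :: "nat \<Rightarrow> 'a set"
  assumes X: "finite X"
    and s: "bij_betw s {..<m} (Pow X)"
    and M: "M \<in> carrier_mat m m"
    and one: "\<And>i j. i < m \<Longrightarrow> j < m \<Longrightarrow> s i \<inter> s j = {} \<Longrightarrow> M $$ (i, j) > 0"
    and zero: "\<And>i j. i < m \<Longrightarrow> j < m \<Longrightarrow> card (s i \<inter> s j) = 1 \<Longrightarrow> M $$ (i, j) = 0"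
    and fact: "nonneg_factorization M r"
  shows "3 ^ card X \<le> r * 2 ^ card X"
proof -
  obtain T U where T: "T \<in> carrier_mat m r" and U: "U \<in> carrier_mat r m"
    and TU: "nonneg_mat T" "nonneg_mat U" "M = T * U"
    using fact M unfolding nonneg_factorization_def by auto
  have Mij: "M $$ (i, j) = (\<Sum>k<r. T $$ (i, k) * U $$ (k, j))" if "i < m" "j < m" for i j
    using that T U by (simp add: TU scalar_prod_def lessThan_atLeast0)
  have nn: "T $$ (i, k) \<ge> 0" "U $$ (k, i) \<ge> 0" if "i < m" "k < r" for i k
    using TU T U that by (auto simp: nonneg_mat_def)
  define A where "A = (\<lambda>k. s ` {i. i < m \<and> T $$ (i, k) > 0})"
  define B where "B = (\<lambda>k. s ` {j. j < m \<and> U $$ (k, j) > 0})"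
  have AB: "A k \<subseteq> Pow X" "B k \<subseteq> Pow X" for k
    using s unfolding A_def B_def bij_betw_def by auto
  have valid: "card (a \<inter> b) \<noteq> 1" if k: "k < r" and ab: "a \<in> A k" "b \<in> B k" for a b k
  proof
    assume c: "card (a \<inter> b) = 1"
    from ab obtain i j where ij: "i < m" "j < m" "a = s i" "b = s j"
      "T $$ (i, k) > 0" "U $$ (k, j) > 0" unfolding A_def B_def by auto
    \<comment> \<open>Nonnegative summands cannot cancel, so one positive summand already makes the
      entry positive.\<close>
    have "T $$ (i, k) * U $$ (k, j) \<le> M $$ (i, j)"
      unfolding Mij[OF ij(1,2)] using k nn ij by (intro member_le_sum) auto
    thus False using zero[of i j] c ij mult_pos_pos[OF ij(5,6)] by simp
  qed
  have "disjoint_pairs (Pow X) (Pow X) \<subseteq> (\<Union>k<r. disjoint_pairs (A k) (B k))"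
  proof clarify
    fix a b assume ab: "(a, b) \<in> disjoint_pairs (Pow X) (Pow X)"
    hence "a \<in> s ` {..<m}" "b \<in> s ` {..<m}"
      using bij_betw_imp_surj_on[OF s] by (simp_all add: disjoint_pairs_def)
    then obtain i j where ij: "i < m" "j < m" "a = s i" "b = s j" by auto
    hence "M $$ (i, j) \<noteq> 0" using one[of i j] ab by (auto simp: disjoint_pairs_def)
    then obtain k where k: "k < r" "T $$ (i, k) * U $$ (k, j) \<noteq> 0"
      unfolding Mij[OF ij(1,2)] by (metis (no_types, lifting) lessThan_iff sum.neutral)
    hence "T $$ (i, k) > 0" "U $$ (k, j) > 0"
      using nn[of i k] nn[of j k] ij by (auto simp: less_le)
    hence "a \<in> A k" "b \<in> B k" using ij unfolding A_def B_def by auto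
    thus "(a, b) \<in> (\<Union>k<r. disjoint_pairs (A k) (B k))"
      using k ab by (auto simp: disjoint_pairs_def)
  qed
  hence "card (disjoint_pairs (Pow X) (Pow X)) \<le> card (\<Union>k<r. disjoint_pairs (A k) (B k))"
    by (intro card_mono finite_UN_I finite_disjoint_pairs) (auto simp: A_def B_def)
  also have "\<dots> \<le> (\<Sum>k<r. card (disjoint_pairs (A k) (B k)))" by (intro card_UN_le) simp
  also have "\<dots> \<le> (\<Sum>k<r. 2 ^ card X)"
    using AB valid X by (intro sum_mono card_disjoint_pairs_rectangle_le) auto
  finally show ?thesis using card_disjoint_pairs_Pow_ge[OF X] by simp
qed

lemma psd_mat_outer: "psd_mat r (mat r r (\<lambda>(k, l). f k * f l))" (is "psd_mat r ?P")
proof -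
  have "0 \<le> v \<bullet> (?P *\<^sub>v v)" if v: "v \<in> carrier_vec r" for v
  proof -
    have "v \<bullet> (?P *\<^sub>v v) = (\<Sum>k<r. f k * v $ k)\<^sup>2"
      using v by (simp add: scalar_prod_def power2_eq_square sum_product sum_distrib_left
          mult_ac lessThan_atLeast0)
    thus ?thesis by simp
  qed
  moreover have "transpose_mat ?P = ?P" by (intro eq_matI) auto
  ultimately show ?thesis by (simp add: psd_mat_def)
qed

text \<open>The trace of the product of two outer squares is the squared inner product of their
  vectors, so a length-\<open>r\<close> factorization of an entrywise root yields PSD factors of
  size \<open>r\<close>.\<close>

lemma psd_factorization_entrywise_square:
  fixes f g :: "nat \<Rightarrow> nat \<Rightarrow> real"
  assumes "\<And>i j. i < dim_row A \<Longrightarrow> j < dim_col A \<Longrightarrow> A $$ (i, j) = (\<Sum>k<r. f i k * g j k)\<^sup>2"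
  shows "psd_factorization A r"
proof -
  define P where "P = (\<lambda>f :: nat \<Rightarrow> real. mat r r (\<lambda>(k, l). f k * f l))"
  have "mat_trace (P f * P g) = (\<Sum>k<r. f k * g k)\<^sup>2" for f g
    by (simp add: P_def mat_trace_def scalar_prod_def power2_eq_square sum_product
        mult_ac lessThan_atLeast0)
  moreover have "psd_mat r (P f)" for f unfolding P_def by (rule psd_mat_outer)
  ultimately show ?thesis unfolding psd_factorization_def
    by (intro exI[of _ "\<lambda>i. P (f i)"] exI[of _ "\<lambda>j. P (g j)"]) (simp add: assms)
qed

theorem corollary19:
  shows "\<exists>c > (0::real). \<exists>C > (0::real). \<exists>N :: nat. \<forall>n :: nat. n \<ge> 1 \<longrightarrow>
    (\<exists>M \<in> carrier_mat (2 ^ n) (2 ^ n). nonneg_mat M \<and>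
      (n \<ge> N \<longrightarrow> real (nonneg_rank M) \<ge> 2 powr (c * real n)) \<and>
      real (psd_rank M) \<le> C * real n)"
proof -
  \<comment> \<open>The exponent 1/2 works because \<open>sqrt 2 \<le> 3 / 2\<close>, and the factor
    2 because \<open>n + 1 \<le> 2 * n\<close> for \<open>n \<ge> 1\<close>. Both bounds hold from
    \<open>n = 1\<close> on, so the threshold can be 0.\<close>
  have "\<exists>M \<in> carrier_mat (2 ^ n) (2 ^ n). nonneg_mat M \<and>
      real (nonneg_rank M) \<ge> 2 powr (1 / 2 * real n) \<and> real (psd_rank M) \<le> 2 * real n"
    if n: "n \<ge> 1" for n :: nat
  proof -
    obtain s where s: "bij_betw s {..<2 ^ n :: nat} (Pow {..<n})"
      using ex_bij_betw_nat_finite[of "Pow {..<n}"] by (auto simp: card_Pow lessThan_atLeast0)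
    define M where "M = mat (2 ^ n) (2 ^ n) (\<lambda>(i, j). (1 - real (card (s i \<inter> s j)))\<^sup>2)"
    have car: "M \<in> carrier_mat (2 ^ n) (2 ^ n)" and nn: "nonneg_mat M"
      by (auto simp: M_def nonneg_mat_def)
    have "nonneg_factorization M (nonneg_rank M)"
      unfolding nonneg_rank_def by (rule LeastI, rule nonneg_factorization_exists, rule nn)
    hence "3 ^ card {..<n} \<le> nonneg_rank M * 2 ^ card {..<n}"
      by (intro nonneg_factorization_disjointness_ge[OF _ s car]) (auto simp: M_def)
    hence "real (3 ^ n) \<le> real (nonneg_rank M * 2 ^ n)" by (subst of_nat_le_iff) simp
    hence "(3 / 2) ^ n \<le> real (nonneg_rank M)" by (simp add: field_simps)
    moreover have "2 powr (1 / 2 * real n) = sqrt 2 ^ n"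
      by (simp add: powr_half_sqrt[symmetric] powr_powr powr_realpow[symmetric])
    moreover have "sqrt 2 \<le> 3 / 2" by (rule real_le_lsqrt) (auto simp: power2_eq_square)
    hence "sqrt 2 ^ n \<le> (3 / 2) ^ n" by (intro power_mono) auto
    ultimately have rank: "2 powr (1 / 2 * real n) \<le> real (nonneg_rank M)" by linarith
    \<comment> \<open>The first \<open>n\<close> coordinates carry the indicator vectors of the two
      sets, negated on the row side; the extra coordinate \<open>n\<close> contributes the constant
      1, so the inner product is 1 minus the size of the intersection.\<close>
    have "psd_factorization M (Suc n)"
    proof (rule psd_factorization_entrywise_square
        [where f = "\<lambda>i k. if k = n then 1 else - of_bool (k \<in> s i)"
           and g = "\<lambda>j k. if k = n then 1 else of_bool (k \<in> s j)"])
      fix i j assume ij: "i < dim_row M" "j < dim_col M"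
      hence "s i \<subseteq> {..<n}" using s by (auto simp: M_def bij_betw_def)
      hence "s i \<inter> s j = {k \<in> {..<n}. k \<in> s i \<and> k \<in> s j}" by auto
      hence "real (card (s i \<inter> s j)) = (\<Sum>k<n. of_bool (k \<in> s i) * of_bool (k \<in> s j))"
        by (simp add: Int_def flip: of_bool_conj)
      thus "M $$ (i, j) = (\<Sum>k<Suc n. (if k = n then 1 else - of_bool (k \<in> s i)) *
          (if k = n then 1 else of_bool (k \<in> s j)))\<^sup>2"
        using ij by (simp add: M_def sum_negf)
    qed
    hence "psd_rank M \<le> Suc n" unfolding psd_rank_def by (rule Least_le)
    thus ?thesis using car nn rank n by (intro bexI[of _ M]) auto
  qed
  thus ?thesis
    by (intro exI[of _ "1 / 2 :: real"] exI[of _ "2 :: real"] conjI exI[of _ "0 :: nat"]) auto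
qed

end
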